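(* Let $n\ge2$ be an integer, $\mathbf{p}\in\mathcal{P}_n$, $\alpha\in(0,\infty)$, and let $f$ be a strictly monotonic real-valued function, defined on a set of real numbers containing $\|\mathbf{q}\|_\alpha$ for all $\mathbf{q}\in\mathcal{P}_n$. Put $\bar{\mathbf{v}}_n(\mathbf{p}) := \mathbf{v}_n\bigl(H_{\mathbf{v}_n}^{-1}(H(\mathbf{p}))\bigr)$ and $\bar{\mathbf{w}}_n(\mathbf{p}) := \mathbf{w}_n\bigl(H_{\mathbf{w}_n}^{-1}(H(\mathbf{p}))\bigr)$. (i) If $f$ is strictly increasing, then $f(\|\bar{\mathbf{w}}_n(\mathbf{p})\|_\alpha) \le f(\|\mathbf{p}\|_\alpha) \le f(\|\bar{\mathbf{v}}_n(\mathbf{p})\|_\alpha)$. (ii) If $f$ is strictly decreasing, then $f(\|\bar{\mathbf{v}}_n(\mathbf{p})\|_\alpha) \le f(\|\mathbf{p}\|_\alpha) \le f(\|\bar{\mathbf{w}}_n(\mathbf{p})\|_\alpha)$.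
   Context: $\mathcal{P}_n = \{(p_1,\dots,p_n)\in\mathbb{R}^n : p_i \ge 0,\ \sum_{i=1}^n p_i = 1\}$. The Shannon entropy is $H(\mathbf{p}) = -\sum_{i=1}^n p_i \ln p_i$ with $0\ln 0 = 0$ (natural logarithm). For $\alpha\in(0,\infty)$, $\|\mathbf{p}\|_\alpha = \bigl(\sum_{i=1}^n p_i^\alpha\bigr)^{1/\alpha}$. For $p\in[0,\frac1{n-1}]$, $\mathbf{v}_n(p) = (1-(n-1)p,\, p,\, \dots,\, p) \in \mathcal{P}_n$. For $p \in [\frac1n, 1]$, $\mathbf{w}_n(p) = (w_1(p),\dots,w_n(p)) \in \mathcal{P}_n$ with $w_i(p) = p$ if $1\le i\le \lfloor p^{-1}\rfloor$, $w_i(p) = 1-\lfloor p^{-1}\rfloor p$ if $i = \lfloor p^{-1}\rfloor + 1$, and $w_i(p)=0$ otherwise. Write $H_{\mathbf{v}_n}(p) = H(\mathbf{v}_n(p))$ and $H_{\mathbf{w}_n}(p) = H(\mathbf{w}_n(p))$. The function $H_{\mathbf{v}_n}$ is a continuous strictly increasing bijection $[0,\frac1n]\to[0,\ln n]$, with inverse $H_{\mathbf{v}_n}^{-1}:[0,\ln n]\to[0,\frac1n]$; the function $H_{\mathbf{w}_n}$ is a continuous strictly decreasing bijection $[\frac1n,1]\to[0,\ln n]$, with inverse $H_{\mathbf{w}_n}^{-1}:[0,\ln n]\to[\frac1n,1]$. *)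

theory Defs
  imports Complex_Main
begin

text \<open>
  A vector of \<open>\<real>\<^sup>n\<close> is a function \<open>nat \<Rightarrow> real\<close> that vanishes outside the index
  set \<open>{1..n}\<close>, so that function equality is equality of vectors.
\<close>

definition prob_simplex :: "nat \<Rightarrow> (nat \<Rightarrow> real) set" where
  "prob_simplex n =
    {p. (\<forall>i\<in>{1..n}. 0 \<le> p i) \<and> (\<Sum>i=1..n. p i) = 1 \<and> (\<forall>i. i \<notin> {1..n} \<longrightarrow> p i = 0)}"

text \<open>The convention \<open>0 ln 0 = 0\<close> holds because \<open>ln 0\<close> is multiplied by \<open>0\<close>.\<close>

definition shannon_entropy :: "nat \<Rightarrow> (nat \<Rightarrow> real) \<Rightarrow> real" where
  "shannon_entropy n p = - (\<Sum>i=1..n. p i * ln (p i))"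

text \<open>Zero entries contribute nothing, since \<open>0 powr \<alpha> = 0\<close>.\<close>

definition alpha_norm :: "nat \<Rightarrow> real \<Rightarrow> (nat \<Rightarrow> real) \<Rightarrow> real" where
  "alpha_norm n \<alpha> p = (\<Sum>i=1..n. p i powr \<alpha>) powr (1 / \<alpha>)"

definition vdist :: "nat \<Rightarrow> real \<Rightarrow> nat \<Rightarrow> real" where
  "vdist n p i =
    (if i = 1 then 1 - (real n - 1) * p
     else if i \<in> {2..n} then p
     else 0)"

definition wdist :: "nat \<Rightarrow> real \<Rightarrow> nat \<Rightarrow> real" where
  "wdist n p i =
    (let m = nat \<lfloor>1 / p\<rfloor> in
     if i \<notin> {1..n} then 0
     else if i \<le> m then p
     else if i = m + 1 then 1 - real m * p
     else 0)"

text \<open>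
  The following two functions invert the entropy along the two families; the entropy is a
  bijection from \<open>{0..1/n}\<close>, respectively \<open>{1/n..1}\<close>, onto \<open>{0..ln n}\<close>, and only the values
  on \<open>{0..ln n}\<close> are meaningful.
\<close>

definition inv_entropy_v :: "nat \<Rightarrow> real \<Rightarrow> real" where
  "inv_entropy_v n = inv_into {0..1 / real n} (\<lambda>p. shannon_entropy n (vdist n p))"

definition inv_entropy_w :: "nat \<Rightarrow> real \<Rightarrow> real" where
  "inv_entropy_w n = inv_into {1 / real n..1} (\<lambda>p. shannon_entropy n (wdist n p))"

definition vbar :: "nat \<Rightarrow> (nat \<Rightarrow> real) \<Rightarrow> nat \<Rightarrow> real" where
  "vbar n p = vdist n (inv_entropy_v n (shannon_entropy n p))"

definition wbar :: "nat \<Rightarrow> (nat \<Rightarrow> real) \<Rightarrow> nat \<Rightarrow> real" where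
  "wbar n p = wdist n (inv_entropy_w n (shannon_entropy n p))"

end

theory Submission
  imports Defs "HOL-Analysis.Convex" "HOL-Library.Multiset" "HOL-Real_Asymp.Real_Asymp"
begin

text \<open>
  It suffices to compare the power sums at fixed total mass and fixed entropy. Every function
  \<open>\<psi> u = u\<^sup>\<alpha> - a - b u - c u ln u\<close> is concave and then convex, so its sign is determined by three
  zeros counted with multiplicity. A comparison of two vectors of the same length, mass and entropy
  follows by summing a suitable \<open>\<psi>\<close> over their entries.

  Upper bound: if \<open>v\<close> has entries \<open>a \<ge> t\<close>, where \<open>t\<close> is repeated, then no vector of the same entropy has
  an entry above \<open>a\<close>, because the entropy given one entry is largest when the others are equal. The \<open>\<psi>\<close>
  with a double zero at \<open>t\<close> and a simple zero at \<open>a\<close> is nonpositive on \<open>[0, a]\<close>.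

  Lower bound, by induction on the number \<open>k\<close> of entries: if the entropy exceeds that of the uniform
  vector with \<open>k - 1\<close> entries, the dual argument works with a double zero at the repeated entry of the
  vector \<open>w\<close>. Otherwise the entries other than the smallest one are first put into the form of \<open>w\<close> by
  induction, and then the smallest entry is moved to \<open>0\<close> by a comparison with three simple zeros.
\<close>

section \<open>The function u ln u: continuity and tangent bounds\<close>

definition xlnx :: "real \<Rightarrow> real" where
  "xlnx u = u * ln u"

lemma xlnx_0 [simp]: "xlnx 0 = 0"
  by (simp add: xlnx_def)

lemma xlnx_1 [simp]: "xlnx 1 = 0"
  by (simp add: xlnx_def)

lemma continuous_on_xlnx: "continuous_on {0..} xlnx"
proof -
  have "continuous (at x within {0..}) xlnx" if "x \<ge> 0" for x
  proof (cases "x = 0")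
    case True
    have "(xlnx \<longlongrightarrow> 0) (at_right 0)"
      unfolding xlnx_def by real_asymp
    then have "(xlnx \<longlongrightarrow> 0) (at 0 within {0..})"
      by (metis at_within_Ici_at_right)
    then show ?thesis
      using True by (simp add: continuous_within)
  next
    case False
    then have "isCont xlnx x"
      unfolding xlnx_def using that by (intro continuous_intros) auto
    then show ?thesis
      by (rule continuous_at_imp_continuous_at_within)
  qed
  then show ?thesis
    by (auto simp: continuous_on_eq_continuous_within)
qed

lemma continuous_on_xlnx_comp [continuous_intros]:
  assumes "continuous_on S f" and "\<And>x. x \<in> S \<Longrightarrow> 0 \<le> f x"
  shows "continuous_on S (\<lambda>x. xlnx (f x))"
  using continuous_on_compose2[OF continuous_on_xlnx assms(1)] assms(2) by auto

lemma has_real_derivative_xlnx: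
  assumes "0 < x"
  shows "(xlnx has_real_derivative ln x + 1) (at x)"
  unfolding xlnx_def using assms by (auto intro!: derivative_eq_intros)

text \<open>Strict convexity: \<open>ln y < y - 1\<close> at \<open>y = t / x\<close>, multiplied by
  \<open>x\<close>. At \<open>x = 0\<close> the tangent has the negative value
  \<open>- t\<close>.\<close>

lemma xlnx_gt_tangent:
  assumes "0 \<le> x" "0 < t" "x \<noteq> t"
  shows "xlnx t + (ln t + 1) * (x - t) < xlnx x"
proof (cases "x = 0")
  case True
  then show ?thesis
    using assms by (simp add: xlnx_def algebra_simps)
next
  case False
  then have x: "0 < x"
    using assms by simp
  have "t / x \<noteq> 1"
    using x assms by simp
  then have "ln (t / x) < t / x - 1"
    using x assms ln_le_minus_one[of "t / x"] ln_eq_minus_one[of "t / x"] by fastforce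
  then have "x * ln (t / x) < x * (t / x - 1)"
    using x by simp
  then show ?thesis
    using x assms by (simp add: xlnx_def ln_div algebra_simps)
qed

lemma xlnx_ge_tangent:
  assumes "0 \<le> x" "0 < t"
  shows "xlnx t + (ln t + 1) * (x - t) \<le> xlnx x"
  using xlnx_gt_tangent[OF assms] by (cases "x = t") auto

lemma xlnx_le_mult_ln:
  assumes "0 \<le> x" "x \<le> t"
  shows "xlnx x \<le> x * ln t"
  using assms by (cases "x = 0") (auto simp: xlnx_def intro!: mult_left_mono)

lemma xlnx_less_mult_ln:
  assumes "0 < x" "x < t"
  shows "xlnx x < x * ln t"
  using assms by (auto simp: xlnx_def)

section \<open>Monotonicity of the two-level entropy on either side of its balanced point\<close>

text \<open>The negated entropy of \<open>m\<close> entries equal to \<open>p\<close> and one entry \<open>s - m p\<close>.\<close>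

definition two_level :: "nat \<Rightarrow> real \<Rightarrow> real \<Rightarrow> real" where
  "two_level m s p = real m * xlnx p + xlnx (s - real m * p)"

lemma continuous_on_two_level:
  assumes "S \<subseteq> {0..s / real m}" "0 < m"
  shows "continuous_on S (two_level m s)"
proof -
  have "real m * x \<le> s" if "x \<in> S" for x
    using that assms by (auto simp: field_simps dest!: subsetD)
  then show ?thesis
    unfolding two_level_def using assms by (intro continuous_intros) auto
qed

lemma two_level_balanced:
  assumes "0 < s"
  shows "two_level m s (s / (real m + 1)) = s * ln (s / (real m + 1))"
proof -
  have "s - real m * (s / (real m + 1)) = s / (real m + 1)"
    by (simp add: field_simps)
  then have "two_level m s (s / (real m + 1)) = (real m + 1) * xlnx (s / (real m + 1))"
    by (simp only: two_level_def) (simp add: algebra_simps)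
  then show ?thesis
    by (simp add: xlnx_def)
qed

lemma two_level_full:
  assumes "0 < m"
  shows "two_level m s (s / real m) = s * ln (s / real m)"
  using assms by (simp add: two_level_def xlnx_def)

lemma has_real_derivative_two_level:
  assumes "0 < x" "0 < s - real m * x"
  shows "(two_level m s has_real_derivative real m * (ln x - ln (s - real m * x))) (at x)"
proof -
  have "((\<lambda>x. xlnx (s - real m * x)) has_real_derivative (ln (s - real m * x) + 1) * (- real m)) (at x)"
    by (rule DERIV_chain2[where f = xlnx and g = "\<lambda>x. s - real m * x"])
      (use assms in \<open>auto intro!: derivative_eq_intros has_real_derivative_xlnx\<close>)
  then have "(two_level m s has_real_derivative
      real m * (ln x + 1) + (ln (s - real m * x) + 1) * (- real m)) (at x)"
    unfolding two_level_def using has_real_derivative_xlnx[OF assms(1)]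
    by (intro DERIV_add DERIV_cmult) auto
  then show ?thesis
    by (simp add: algebra_simps)
qed

text \<open>The derivative is a positive multiple of \<open>ln x - ln (s - real m * x)\<close>, so
  its sign changes at \<open>s / (real m + 1)\<close>, where the repeated and the remaining entry
  agree. Only interior derivatives are used, since the remaining entry may vanish at
  \<open>y = s / real m\<close>.\<close>

lemma two_level_strict_increasing:
  assumes "0 < m" "0 < s" "s / (real m + 1) \<le> x" "x < y" "y \<le> s / real m"
  shows "two_level m s x < two_level m s y"
proof (rule DERIV_pos_imp_increasing_open[OF \<open>x < y\<close>])
  have x0: "0 < x"
    using assms by (smt (verit) divide_pos_pos of_nat_0_less_iff)
  show "continuous_on {x..y} (two_level m s)"
    using assms x0 by (intro continuous_on_two_level) auto
  fix u assume u: "x < u" "u < y"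
  have "real m * u < real m * y" "(real m + 1) * x < (real m + 1) * u"
    using u assms(1) by (auto intro!: mult_strict_left_mono)
  moreover have "real m * y \<le> s" "s \<le> (real m + 1) * x"
    using assms by (auto simp: field_simps)
  ultimately have "0 < s - real m * u" "s - real m * u < u"
    by (auto simp: algebra_simps)
  then show "\<exists>d. DERIV (two_level m s) u :> d \<and> 0 < d"
    using has_real_derivative_two_level[of u s m] x0 u assms(1)
    by (intro exI[of _ "real m * (ln u - ln (s - real m * u))"]) auto
qed

lemma two_level_strict_decreasing:
  assumes "0 < m" "0 < s" "0 \<le> x" "x < y" "y \<le> s / (real m + 1)"
  shows "two_level m s y < two_level m s x"
proof (rule DERIV_neg_imp_decreasing_open[OF \<open>x < y\<close>])
  have "s / (real m + 1) \<le> s / real m"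
    using assms by (intro divide_left_mono) auto
  then show "continuous_on {x..y} (two_level m s)"
    using assms by (intro continuous_on_two_level) auto
  fix u assume u: "x < u" "u < y"
  have "(real m + 1) * u < (real m + 1) * y"
    using u by (intro mult_strict_left_mono) auto
  moreover have "(real m + 1) * y \<le> s"
    using assms(5) by (simp add: field_simps)
  ultimately have "u < s - real m * u"
    by (auto simp: algebra_simps)
  then show "\<exists>d. DERIV (two_level m s) u :> d \<and> d < 0"
    using has_real_derivative_two_level[of u s m] u assms(1,3)
    by (intro exI[of _ "real m * (ln u - ln (s - real m * u))"]) (auto intro!: mult_pos_neg)
qed

subsection \<open>Signs of combinations of \<open>u\<^sup>\<alpha>\<close>, \<open>1\<close>, \<open>u\<close> and \<open>u ln u\<close>\<close>

text \<open>\<open>a\<close>, \<open>b\<close>, \<open>c\<close> act as Lagrange multipliers for the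
  number of entries, the mass and the entropy: summed over vectors that share these three, the
  combination differs from the power sum by a constant.\<close>

definition pe_comb :: "real \<Rightarrow> real \<Rightarrow> real \<Rightarrow> real \<Rightarrow> real \<Rightarrow> real" where
  "pe_comb \<alpha> a b c u = u powr \<alpha> - a - b * u - c * xlnx u"

definition pe_deriv :: "real \<Rightarrow> real \<Rightarrow> real \<Rightarrow> real \<Rightarrow> real" where
  "pe_deriv \<alpha> b c u = \<alpha> * u powr (\<alpha> - 1) - b - c * (ln u + 1)"

lemma has_real_derivative_pe_comb:
  assumes "0 < u"
  shows "(pe_comb \<alpha> a b c has_real_derivative pe_deriv \<alpha> b c u) (at u)"
  unfolding pe_comb_def[abs_def] pe_deriv_def using assms
  by (auto intro!: derivative_eq_intros has_real_derivative_powr has_real_derivative_xlnx)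

text \<open>The factor \<open>1 / u\<close> is split off so that the sign of the second derivative
  is that of a numerator monotone in \<open>u\<close>.\<close>

lemma has_real_derivative_pe_deriv:
  assumes "0 < u"
  shows "(pe_deriv \<alpha> b c has_real_derivative (\<alpha> * (\<alpha> - 1) * u powr (\<alpha> - 1) - c) / u) (at u)"
proof -
  have "(pe_deriv \<alpha> b c has_real_derivative
      \<alpha> * ((\<alpha> - 1) * u powr (\<alpha> - 1 - 1)) - 0 - c * (1 / u + 0)) (at u)"
    unfolding pe_deriv_def[abs_def] using assms
    by (intro DERIV_diff DERIV_cmult DERIV_add has_real_derivative_powr DERIV_const)
      (auto intro!: derivative_eq_intros)
  moreover have "u powr (\<alpha> - 1 - 1) = u powr (\<alpha> - 1) / u"
    using assms by (simp add: powr_diff power2_eq_square)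
  ultimately show ?thesis
    by (simp add: diff_divide_distrib mult.assoc)
qed

lemma continuous_on_pe_comb:
  assumes "0 < \<alpha>" "S \<subseteq> {0..}"
  shows "continuous_on S (pe_comb \<alpha> a b c)"
  unfolding pe_comb_def[abs_def] using assms
  by (intro continuous_intros continuous_on_powr') auto

text \<open>For \<alpha> below 1 the coefficient is negative and the power decreasing, so both signs
  flip. Hence curvature passes from concave to convex for every positive \<alpha>.\<close>

lemma powr_second_order_mono:
  assumes "0 < (\<alpha>::real)" "0 < u" "u \<le> v"
  shows "\<alpha> * (\<alpha> - 1) * u powr (\<alpha> - 1) \<le> \<alpha> * (\<alpha> - 1) * v powr (\<alpha> - 1)"
proof (cases "1 \<le> \<alpha>")
  case True
  then show ?thesis
    using assms by (intro mult_left_mono powr_mono2) auto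
next
  case False
  then show ?thesis
    using assms by (intro mult_left_mono_neg powr_mono2') (auto intro: mult_nonneg_nonpos)
qed

text \<open>The second derivative vanishes at \<open>d\<close>, so \<open>\<psi>\<close> is concave
  on (0, d] and convex from \<open>d\<close> on. The affine coefficients \<open>a\<close> and
  \<open>b\<close> do not affect curvature and stay arbitrary.\<close>

locale pe_inflection =
  fixes \<alpha> a b c d :: real
  assumes pos: "0 < \<alpha>" "0 < d"
    and inflection: "\<alpha> * (\<alpha> - 1) * d powr (\<alpha> - 1) = c"
begin

abbreviation "\<psi> \<equiv> pe_comb \<alpha> a b c"

lemma above_tangent:
  assumes "d \<le> u" "d \<le> v"
  shows "\<psi> u + pe_deriv \<alpha> b c u * (v - u) \<le> \<psi> v"
proof -
  have "pe_deriv \<alpha> b c u * (v - u) \<le> \<psi> v - \<psi> u"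
  proof (rule f''_imp_f'[where C = "{d..}" and f = \<psi>])
    fix x assume "x \<in> {d..}"
    then show "0 \<le> (\<alpha> * (\<alpha> - 1) * x powr (\<alpha> - 1) - c) / x"
      using powr_second_order_mono[of \<alpha> d x] pos inflection by (intro divide_nonneg_pos) auto
  qed (use assms pos has_real_derivative_pe_comb has_real_derivative_pe_deriv in auto)
  then show ?thesis by simp
qed

lemma below_tangent:
  assumes "0 < u" "u \<le> d" "0 < v" "v \<le> d"
  shows "\<psi> v \<le> \<psi> u + pe_deriv \<alpha> b c u * (v - u)"
proof -
  have "- pe_deriv \<alpha> b c u * (v - u) \<le> - \<psi> v - (- \<psi> u)"
  proof (rule f''_imp_f'[where C = "{0<..d}" and f = "\<lambda>x. - \<psi> x"
        and f' = "\<lambda>x. - pe_deriv \<alpha> b c x"])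
    fix x assume "x \<in> {0<..d}"
    then show "0 \<le> - ((\<alpha> * (\<alpha> - 1) * x powr (\<alpha> - 1) - c) / x)"
      using powr_second_order_mono[of \<alpha> x d] pos inflection
      by (auto intro!: divide_nonpos_pos)
  qed (use assms pos has_real_derivative_pe_comb has_real_derivative_pe_deriv in
      \<open>auto intro!: DERIV_minus\<close>)
  then show ?thesis by simp
qed

text \<open>The tangent at \<open>v\<close> is compared with both ends, weighted by
  \<open>w - v\<close> and \<open>v - u\<close> so that the slopes cancel. Avoiding division also
  covers \<open>u = w\<close>.\<close>

lemma below_chord:
  assumes "d \<le> u" "u \<le> v" "v \<le> w"
  shows "(w - u) * \<psi> v \<le> (w - v) * \<psi> u + (v - u) * \<psi> w"
proof -
  have "(w - v) * (\<psi> v + pe_deriv \<alpha> b c v * (u - v)) \<le> (w - v) * \<psi> u"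
    using assms by (intro mult_left_mono above_tangent) auto
  moreover have "(v - u) * (\<psi> v + pe_deriv \<alpha> b c v * (w - v)) \<le> (v - u) * \<psi> w"
    using assms by (intro mult_left_mono above_tangent) auto
  ultimately show ?thesis
    by (simp add: algebra_simps)
qed

lemma above_chord:
  assumes "0 < u" "u \<le> v" "v \<le> w" "w \<le> d"
  shows "(w - v) * \<psi> u + (v - u) * \<psi> w \<le> (w - u) * \<psi> v"
proof -
  have "(w - v) * \<psi> u \<le> (w - v) * (\<psi> v + pe_deriv \<alpha> b c v * (u - v))"
    using assms by (intro mult_left_mono below_tangent) auto
  moreover have "(v - u) * \<psi> w \<le> (v - u) * (\<psi> v + pe_deriv \<alpha> b c v * (w - v))"
    using assms by (intro mult_left_mono below_tangent) auto
  ultimately show ?thesis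
    by (simp add: algebra_simps)
qed

lemma nonpos_between:
  assumes "d \<le> u" "u \<le> v" "v \<le> w" "\<psi> u \<le> 0" "\<psi> w \<le> 0"
  shows "\<psi> v \<le> 0"
proof (cases "u < w")
  case True
  have "(w - u) * \<psi> v \<le> 0"
    using below_chord[OF assms(1-3)] assms
      mult_nonneg_nonpos[of "w - v" "\<psi> u"] mult_nonneg_nonpos[of "v - u" "\<psi> w"] by linarith
  then show ?thesis
    using True by (simp add: mult_le_0_iff)
next
  case False
  then have "v = u"
    using assms by linarith
  then show ?thesis
    using assms by simp
qed

lemma nonneg_between:
  assumes "0 < u" "u \<le> v" "v \<le> w" "w \<le> d" "0 \<le> \<psi> u" "0 \<le> \<psi> w"
  shows "0 \<le> \<psi> v"
proof (cases "u < w")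
  case True
  have "0 \<le> (w - u) * \<psi> v"
    using above_chord[OF assms(1-4)] assms
      mult_nonneg_nonneg[of "w - v" "\<psi> u"] mult_nonneg_nonneg[of "v - u" "\<psi> w"] by linarith
  then show ?thesis
    using True by (simp add: zero_le_mult_iff)
next
  case False
  then have "v = u"
    using assms by linarith
  then show ?thesis
    using assms by simp
qed

text \<open>Extrapolation: to the left of \<open>v\<close>, a concave function lies below the line
  through its points at \<open>v\<close> and \<open>w\<close>.\<close>

lemma nonpos_below:
  assumes "0 < u" "u \<le> v" "v < w" "w \<le> d" "\<psi> v = 0" "0 \<le> \<psi> w"
  shows "\<psi> u \<le> 0"
proof -
  have "(w - v) * \<psi> u \<le> 0"
    using above_chord[of u v w] assms mult_nonneg_nonneg[of "v - u" "\<psi> w"] by (simp del: mult_nonneg_nonneg)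
  then show ?thesis
    using assms by (simp add: mult_le_0_iff)
qed

lemma nonneg_below:
  assumes "d \<le> u" "u \<le> v" "v < w" "\<psi> v = 0" "\<psi> w = 0"
  shows "0 \<le> \<psi> u"
proof -
  have "0 \<le> (w - v) * \<psi> u"
    using below_chord[of u v w] assms by auto
  then show ?thesis
    using assms by (simp add: zero_le_mult_iff)
qed

end

text \<open>The derivative formulas hold only for positive arguments, so the sign at 0 is obtained
  as a one-sided limit.\<close>

lemma pe_comb_nonpos_at_0:
  assumes "0 < \<alpha>" "0 < e" "\<And>u. 0 < u \<Longrightarrow> u \<le> e \<Longrightarrow> pe_comb \<alpha> a b c u \<le> 0"
  shows "pe_comb \<alpha> a b c 0 \<le> 0"
proof (rule tendsto_upperbound)
  have "continuous (at 0 within {0..}) (pe_comb \<alpha> a b c)"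
    using continuous_on_pe_comb[OF assms(1), of "{0..}" a b c]
    by (auto simp: continuous_on_eq_continuous_within)
  then show "(pe_comb \<alpha> a b c \<longlongrightarrow> pe_comb \<alpha> a b c 0) (at_right 0)"
    by (metis at_within_Ici_at_right continuous_within)
  show "\<forall>\<^sub>F u in at_right 0. pe_comb \<alpha> a b c u \<le> 0"
    using assms(2,3) by (auto simp: eventually_at_right_field intro!: exI[of _ e])
qed simp

section \<open>Sign patterns from zeros, by Rolle's theorem\<close>

lemma pe_comb_Rolle:
  assumes "0 < x" "x < y" "pe_comb \<alpha> a b c x = pe_comb \<alpha> a b c y"
  obtains z where "x < z" "z < y" "pe_deriv \<alpha> b c z = 0"
proof -
  have D: "(pe_comb \<alpha> a b c has_real_derivative pe_deriv \<alpha> b c u) (at u)" if "x \<le> u" for u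
    using has_real_derivative_pe_comb that assms by simp
  then have "continuous_on {x..y} (pe_comb \<alpha> a b c)"
    by (meson DERIV_atLeastAtMost_imp_continuous_on)
  then obtain z where z: "x < z" "z < y" "DERIV (pe_comb \<alpha> a b c) z :> 0"
    using Rolle[of x y "pe_comb \<alpha> a b c"] assms(2,3) D
    by (metis less_eq_real_def real_differentiable_def)
  then have "pe_deriv \<alpha> b c z = 0"
    using D[of z] DERIV_unique by (metis less_eq_real_def)
  then show ?thesis
    using that z by blast
qed

lemma pe_deriv_Rolle:
  assumes "0 < \<alpha>" "0 < x" "x < y" "pe_deriv \<alpha> b c x = 0" "pe_deriv \<alpha> b c y = 0"
  obtains d where "x < d" "d < y" "pe_inflection \<alpha> c d"
proof -
  have D: "(pe_deriv \<alpha> b c has_real_derivative (\<alpha> * (\<alpha> - 1) * u powr (\<alpha> - 1) - c) / u) (at u)"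
    if "x \<le> u" for u
    using has_real_derivative_pe_deriv that assms by simp
  then have "continuous_on {x..y} (pe_deriv \<alpha> b c)"
    by (meson DERIV_atLeastAtMost_imp_continuous_on)
  then obtain d where d: "x < d" "d < y" "DERIV (pe_deriv \<alpha> b c) d :> 0"
    using Rolle[of x y "pe_deriv \<alpha> b c"] assms D
    by (metis less_eq_real_def real_differentiable_def)
  then have "(\<alpha> * (\<alpha> - 1) * d powr (\<alpha> - 1) - c) / d = 0"
    using D[of d] DERIV_unique by (metis less_eq_real_def)
  then have "pe_inflection \<alpha> c d"
    using assms d by unfold_locales auto
  then show ?thesis
    using that d by blast
qed

text \<open>Rolle gives a second critical point between \<open>t\<close> and \<open>x\<close>, then
  an inflection point \<open>d\<close> above \<open>t\<close>. Thus \<open>t\<close> lies in the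
  concave part, where its tangent, the zero line, bounds from above; on \<open>[d, x]\<close>
  convexity between nonpositive end values suffices.\<close>

lemma pe_comb_sign_double_low:
  assumes "0 < \<alpha>" "0 < t" "t < x" "pe_comb \<alpha> a b c t = 0" "pe_deriv \<alpha> b c t = 0"
    "pe_comb \<alpha> a b c x = 0" "0 \<le> u" "u \<le> x"
  shows "pe_comb \<alpha> a b c u \<le> 0"
proof -
  obtain z where z: "t < z" "z < x" "pe_deriv \<alpha> b c z = 0"
    using pe_comb_Rolle[of t x \<alpha> a b c] assms by auto
  obtain d where d: "t < d" "d < z" "pe_inflection \<alpha> c d"
    using pe_deriv_Rolle[of \<alpha> t z b c] assms z by auto
  interpret pe_inflection \<alpha> a b c d by (rule d)
  have low: "\<psi> v \<le> 0" if "0 < v" "v \<le> d" for v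
    using below_tangent[of t v] assms d that by auto
  consider "u = 0" | "0 < u" "u \<le> d" | "d \<le> u"
    using assms by linarith
  then show ?thesis
  proof cases
    case 1
    then show ?thesis
      using pe_comb_nonpos_at_0[OF assms(1) pos(2)] low by blast
  next
    case 3
    then show ?thesis
      using nonpos_between[of d u x] low[of d] pos assms by auto
  qed (use low in auto)
qed

text \<open>Mirror image of \<open>pe_comb_sign_double_low\<close>: now \<open>t\<close> lies in the
  convex part, where the zero line is a supporting tangent from below, and \<open>[x, d]\<close> is
  handled by concavity.\<close>

lemma pe_comb_sign_double_high:
  assumes "0 < \<alpha>" "0 < x" "x < t" "pe_comb \<alpha> a b c t = 0" "pe_deriv \<alpha> b c t = 0"
    "pe_comb \<alpha> a b c x = 0" "x \<le> u"
  shows "0 \<le> pe_comb \<alpha> a b c u"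
proof -
  obtain z where z: "x < z" "z < t" "pe_deriv \<alpha> b c z = 0"
    using pe_comb_Rolle[of x t \<alpha> a b c] assms by auto
  obtain d where d: "z < d" "d < t" "pe_inflection \<alpha> c d"
    using pe_deriv_Rolle[of \<alpha> z t b c] assms z by auto
  interpret pe_inflection \<alpha> a b c d by (rule d)
  have high: "0 \<le> \<psi> v" if "d \<le> v" for v
    using above_tangent[of t v] assms d that by auto
  then show ?thesis
    using nonneg_between[of x u d] high[of d] assms by (cases "u \<le> d") auto
qed

lemma pe_comb_sign_three_zeros:
  assumes "0 < \<alpha>" "0 < x" "x < y" "y < z"
    and zeros: "pe_comb \<alpha> a b c x = 0" "pe_comb \<alpha> a b c y = 0" "pe_comb \<alpha> a b c z = 0"
  shows "pe_comb \<alpha> a b c 0 \<le> 0"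
    and "\<And>u. x \<le> u \<Longrightarrow> u \<le> y \<Longrightarrow> 0 \<le> pe_comb \<alpha> a b c u"
    and "\<And>u. y \<le> u \<Longrightarrow> u \<le> z \<Longrightarrow> pe_comb \<alpha> a b c u \<le> 0"
proof -
  obtain v where v: "x < v" "v < y" "pe_deriv \<alpha> b c v = 0"
    using pe_comb_Rolle[of x y \<alpha> a b c] assms by auto
  obtain w where w: "y < w" "w < z" "pe_deriv \<alpha> b c w = 0"
    using pe_comb_Rolle[of y z \<alpha> a b c] assms by auto
  obtain d where d: "v < d" "d < w" "pe_inflection \<alpha> c d"
    using pe_deriv_Rolle[of \<alpha> v w b c] assms v w by auto
  interpret pe_inflection \<alpha> a b c d by (rule d)
  have "\<psi> 0 \<le> 0 \<and> (\<forall>u. x \<le> u \<and> u \<le> y \<longrightarrow> 0 \<le> \<psi> u) \<and> (\<forall>u. y \<le> u \<and> u \<le> z \<longrightarrow> \<psi> u \<le> 0)"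
  \<comment> \<open>The two Rolle steps place \<open>d\<close> strictly between \<open>x\<close> and
    \<open>z\<close>, but the middle zero \<open>y\<close> may lie on either side of it.\<close>
  proof (cases "y \<le> d")
    case True
    have A: "\<psi> u \<le> 0" if "0 < u" "u \<le> x" for u
      using nonpos_below[of u x y] that True assms by auto
    \<comment> \<open>Concavity with zeros at \<open>x\<close> and \<open>y\<close> keeps
      \<open>\<psi>\<close> nonpositive beyond \<open>y\<close>; \<open>B[of d]\<close> then
      supplies the left end value for the convex part.\<close>
    have B: "\<psi> u \<le> 0" if "y \<le> u" "u \<le> d" for u
    proof -
      have "(u - y) * \<psi> x + (y - x) * \<psi> u \<le> (u - x) * \<psi> y"
        using above_chord[of x y u] that assms by auto
      then show ?thesis
        using assms by (simp add: mult_le_0_iff)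
    qed
    have C: "0 \<le> \<psi> u" if "x \<le> u" "u \<le> y" for u
      using nonneg_between[of x u y] that True assms by simp
    have D: "\<psi> u \<le> 0" if "y \<le> u" "u \<le> z" for u
      using B[of u] B[of d] nonpos_between[of d u z] that True d w assms by (cases "u \<le> d") auto
    show ?thesis
      using pe_comb_nonpos_at_0[OF assms(1,2) A] C D by blast
  next
    case False
    \<comment> \<open>Convexity with zeros at \<open>y\<close> and \<open>z\<close> extrapolates to
      the left; \<open>A[of d]\<close> then supplies the right end value for the concave
      part.\<close>
    have A: "0 \<le> \<psi> u" if "d \<le> u" "u \<le> y" for u
      using nonneg_below[of u y z] that False assms by auto
    have B: "\<psi> u \<le> 0" if "0 < u" "u \<le> x" for u
      using nonpos_below[of u x d] that False A[of d] v d assms by auto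
    have C: "0 \<le> \<psi> u" if "x \<le> u" "u \<le> y" for u
      using A[of u] A[of d] nonneg_between[of x u d] that False assms by (cases "d \<le> u") auto
    have D: "\<psi> u \<le> 0" if "y \<le> u" "u \<le> z" for u
      using nonpos_between[of y u z] that False assms by simp
    show ?thesis
      using pe_comb_nonpos_at_0[OF assms(1,2) B] C D by blast
  qed
  then show "\<psi> 0 \<le> 0" "\<And>u. x \<le> u \<Longrightarrow> u \<le> y \<Longrightarrow> 0 \<le> \<psi> u"
    "\<And>u. y \<le> u \<Longrightarrow> u \<le> z \<Longrightarrow> \<psi> u \<le> 0"
    by auto
qed

section \<open>Interpolation: coefficients for prescribed zeros\<close>

lemma pe_comb_exists_double:
  assumes "0 < t" "0 \<le> x" "x \<noteq> t"
  obtains a b c where "pe_comb \<alpha> a b c t = 0" "pe_deriv \<alpha> b c t = 0" "pe_comb \<alpha> a b c x = 0"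
proof -
  \<comment> \<open>\<open>D\<close> is the gap of \<open>xlnx\<close> above its tangent at
    \<open>t\<close>, positive by strict convexity; \<open>c\<close> is the ratio of the
    corresponding gap of the power to it. Tangency at \<open>t\<close> then dictates
    \<open>b\<close> and \<open>a\<close>.\<close>
  define D where "D = xlnx x - xlnx t - (ln t + 1) * (x - t)"
  define c where "c = (x powr \<alpha> - t powr \<alpha> - \<alpha> * t powr (\<alpha> - 1) * (x - t)) / D"
  define b where "b = \<alpha> * t powr (\<alpha> - 1) - c * (ln t + 1)"
  define a where "a = t powr \<alpha> - b * t - c * xlnx t"
  have "D > 0"
    using xlnx_gt_tangent[of x t] assms by (simp add: D_def)
  then have "c * D = x powr \<alpha> - t powr \<alpha> - \<alpha> * t powr (\<alpha> - 1) * (x - t)"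
    by (simp add: c_def)
  then have "pe_comb \<alpha> a b c x = 0"
    unfolding pe_comb_def a_def b_def D_def by (simp add: algebra_simps)
  moreover have "pe_comb \<alpha> a b c t = 0" "pe_deriv \<alpha> b c t = 0"
    by (simp_all add: pe_comb_def pe_deriv_def a_def b_def)
  ultimately show ?thesis
    using that by blast
qed

lemma pe_comb_exists_three_zeros:
  assumes "0 < x" "x < y" "y < z"
  obtains a b c where "pe_comb \<alpha> a b c x = 0" "pe_comb \<alpha> a b c y = 0" "pe_comb \<alpha> a b c z = 0"
proof -
  \<comment> \<open>\<open>C\<close> measures the deviation from collinearity at the three points
    and is positive on \<open>xlnx\<close>. The choice of \<open>c\<close> makes it vanish on
    \<open>h\<close>, so the line \<open>a + b * u\<close> through the outer points of
    \<open>h\<close> also meets the middle one.\<close>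
  define C where "C = (\<lambda>f::real \<Rightarrow> real. (z - y) * f x + (y - x) * f z - (z - x) * f y)"
  define c where "c = C (\<lambda>u. u powr \<alpha>) / C xlnx"
  define h where "h = (\<lambda>u. u powr \<alpha> - c * xlnx u)"
  define b where "b = (h z - h x) / (z - x)"
  define a where "a = h x - b * x"
  have "(z - y) * (xlnx y + (ln y + 1) * (x - y)) < (z - y) * xlnx x"
    using assms by (intro mult_strict_left_mono xlnx_gt_tangent) auto
  moreover have "(y - x) * (xlnx y + (ln y + 1) * (z - y)) < (y - x) * xlnx z"
    using assms by (intro mult_strict_left_mono xlnx_gt_tangent) auto
  ultimately have "C xlnx > 0"
    by (simp add: C_def algebra_simps)
  then have "C (\<lambda>u. u powr \<alpha>) - c * C xlnx = 0"
    by (simp add: c_def)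
  then have Ch: "C h = 0"
    by (simp add: C_def h_def algebra_simps)
  have bz: "b * (z - x) = h z - h x"
    using assms by (simp add: b_def)
  have "(z - x) * (h y - a - b * y) = (z - x) * (h y - h x) - (b * (z - x)) * (y - x)"
    by (simp add: a_def algebra_simps)
  also have "\<dots> = - C h"
    unfolding bz C_def by (simp add: algebra_simps)
  finally have "h y - a - b * y = 0"
    using Ch assms by simp
  moreover have "h z - a - b * z = 0"
    using bz by (simp add: a_def algebra_simps)
  moreover have "h x - a - b * x = 0"
    by (simp add: a_def)
  ultimately show ?thesis
    using that[of a b c] by (simp add: pe_comb_def h_def)
qed

subsection \<open>Comparison of multisets of equal mass and entropy\<close>

lemma sum_mset_nonneg:
  fixes f :: "'a \<Rightarrow> real"
  assumes "\<And>x. x \<in># A \<Longrightarrow> 0 \<le> f x"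
  shows "0 \<le> (\<Sum>x\<in>#A. f x)"
  using assms by (induction A) auto

lemma sum_mset_nonneg_eq_0D:
  fixes f :: "'a \<Rightarrow> real"
  assumes "\<And>x. x \<in># A \<Longrightarrow> 0 \<le> f x" "(\<Sum>x\<in>#A. f x) = 0" "x \<in># A"
  shows "f x = 0"
proof -
  obtain B where B: "A = add_mset x B"
    using assms(3) by (metis insert_DiffM)
  then have "0 \<le> (\<Sum>x\<in>#B. f x)"
    using assms(1) by (intro sum_mset_nonneg) auto
  then show ?thesis
    using assms B by fastforce
qed

lemma member_le_sum_mset:
  fixes A :: "real multiset"
  assumes "\<And>x. x \<in># A \<Longrightarrow> 0 \<le> x" "x \<in># A"
  shows "x \<le> \<Sum>\<^sub># A"
proof -
  obtain B where B: "A = add_mset x B"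
    using assms(2) by (metis insert_DiffM)
  then have "0 \<le> (\<Sum>x\<in>#B. x)"
    using assms(1) by (intro sum_mset_nonneg) auto
  then show ?thesis
    using B by simp
qed

lemma sum_mset_pe_comb:
  "(\<Sum>u\<in>#A. pe_comb \<alpha> a b c u) =
    (\<Sum>u\<in>#A. u powr \<alpha>) - a * real (size A) - b * \<Sum>\<^sub># A - c * (\<Sum>u\<in>#A. xlnx u)"
  by (induction A) (auto simp: pe_comb_def algebra_simps)

lemma sum_xlnx_le_mult_ln:
  assumes "\<And>x. x \<in># A \<Longrightarrow> 0 \<le> x" "\<And>x. x \<in># A \<Longrightarrow> x \<le> t"
  shows "(\<Sum>u\<in>#A. xlnx u) \<le> \<Sum>\<^sub># A * ln t"
  using assms by (induction A) (auto simp: distrib_right intro!: add_mono xlnx_le_mult_ln)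

lemma sum_xlnx_ge_tangent:
  assumes "\<And>x. x \<in># A \<Longrightarrow> 0 \<le> x" "0 < t"
  shows "\<Sum>\<^sub># A * (ln t + 1) - real (size A) * t \<le> (\<Sum>u\<in>#A. xlnx u)"
  using assms(1)
proof (induction A)
  case (add x A)
  then have "x * (ln t + 1) - t \<le> xlnx x"
    using xlnx_ge_tangent[of x t] assms(2) by (simp add: xlnx_def algebra_simps)
  moreover have "\<Sum>\<^sub># A * (ln t + 1) - real (size A) * t \<le> (\<Sum>u\<in>#A. xlnx u)"
    using add by simp
  ultimately show ?case
    by (simp add: algebra_simps)
qed simp

text \<open>Jensen's inequality, by summing tangents at the mean.\<close>

lemma sum_xlnx_ge_uniform:
  assumes "\<And>x. x \<in># A \<Longrightarrow> 0 \<le> x" "0 < \<Sum>\<^sub># A"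
  shows "\<Sum>\<^sub># A * ln (\<Sum>\<^sub># A / real (size A)) \<le> (\<Sum>u\<in>#A. xlnx u)"
proof -
  have "0 < size A"
    using assms(2) by (auto simp: nonempty_has_size[symmetric])
  then have "0 < \<Sum>\<^sub># A / real (size A)" "\<Sum>\<^sub># A / real (size A) * real (size A) = \<Sum>\<^sub># A"
    using assms(2) by auto
  then show ?thesis
    using sum_xlnx_ge_tangent[of A "\<Sum>\<^sub># A / real (size A)"] assms
    by (simp add: algebra_simps)
qed

text \<open>Jensen's inequality for the \<open>m\<close> entries other than \<open>x\<close>. If
  these have mass 0 there is no positive mean at which to take a tangent, so that case is
  separate.\<close>

lemma sum_xlnx_ge_two_level:
  assumes nonneg: "\<And>y. y \<in># A \<Longrightarrow> 0 \<le> y" and m: "0 < m" "size A = Suc m" and x: "x \<in># A"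
  shows "two_level m (\<Sum>\<^sub># A) ((\<Sum>\<^sub># A - x) / real m) \<le> (\<Sum>u\<in>#A. xlnx u)"
proof -
  obtain B where B: "A = add_mset x B"
    using x by (metis insert_DiffM)
  have B_nonneg: "\<And>y. y \<in># B \<Longrightarrow> 0 \<le> y"
    using nonneg B by auto
  have "\<Sum>\<^sub># B * ln (\<Sum>\<^sub># B / real m) \<le> (\<Sum>u\<in>#B. xlnx u)"
  proof (cases "\<Sum>\<^sub># B = 0")
    case True
    then have "y = 0" if "y \<in># B" for y
      using sum_mset_nonneg_eq_0D[of B "\<lambda>x. x" y] B_nonneg that by auto
    then have "0 \<le> (\<Sum>u\<in>#B. xlnx u)"
      by (intro sum_mset_nonneg) (metis order_refl xlnx_0)
    then show ?thesis
      using True by simp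
  next
    case False
    then have "0 < \<Sum>\<^sub># B"
      using sum_mset_nonneg[of B "\<lambda>x. x"] B_nonneg by auto
    then show ?thesis
      using sum_xlnx_ge_uniform[of B] B_nonneg m B by simp
  qed
  then show ?thesis
    using m B by (simp add: two_level_def xlnx_def)
qed

lemma sum_powr_le_two_level:
  assumes nonneg: "\<And>y. y \<in># A \<Longrightarrow> 0 \<le> y" and m: "0 < m" "size A = Suc m"
    and s: "\<Sum>\<^sub># A = s" "0 < s" and t: "0 \<le> t" "t \<le> s / (real m + 1)"
    and entropy: "(\<Sum>u\<in>#A. xlnx u) = two_level m s t" and \<alpha>: "0 < \<alpha>"
  shows "(\<Sum>u\<in>#A. u powr \<alpha>) \<le> real m * t powr \<alpha> + (s - real m * t) powr \<alpha>"
proof -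
  \<comment> \<open>A larger entry would leave the others a mean below \<open>t\<close>, where
    \<open>two_level\<close> is strictly larger, contradicting the entropy.\<close>
  have upper: "x \<le> s - real m * t" if "x \<in># A" for x
  proof (rule ccontr)
    assume "\<not> ?thesis"
    then have "(s - x) / real m < t"
      using m by (simp add: field_simps)
    moreover have "x \<le> s"
      using member_le_sum_mset[of A x] nonneg that s by auto
    ultimately have "two_level m s t < two_level m s ((s - x) / real m)"
      using two_level_strict_decreasing[of m s "(s - x) / real m" t] m s t by auto
    then show False
      using sum_xlnx_ge_two_level[of A m x] nonneg m that s entropy by auto
  qed
  have mt: "(real m + 1) * t \<le> s"
    using t(2) by (simp add: field_simps)
  \<comment> \<open>The interpolation needs a derivative at \<open>t\<close> and two distinct zeros;
    the first two cases are those where one of these fails.\<close>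
  consider "t = 0" | "t = s - real m * t" | "0 < t" "t < s - real m * t"
    using t mt by (fastforce simp: algebra_simps)
  then show ?thesis
  proof cases
    case 1
    have gap: "0 \<le> x * ln s - xlnx x" if "x \<in># A" for x
      using xlnx_le_mult_ln[of x s] upper[OF that] nonneg[OF that] 1 by simp
    have "(\<Sum>x\<in>#A. x * l - xlnx x) = \<Sum>\<^sub># A * l - (\<Sum>u\<in>#A. xlnx u)" for l
      by (induction A) (auto simp: algebra_simps)
    then have "(\<Sum>x\<in>#A. x * ln s - xlnx x) = s * ln s - (\<Sum>u\<in>#A. xlnx u)"
      using s(1) by blast
    also have "\<dots> = 0"
      using entropy 1 by (simp add: two_level_def xlnx_def)
    finally have "x * ln s = xlnx x" if "x \<in># A" for x
      using sum_mset_nonneg_eq_0D[of A "\<lambda>x. x * ln s - xlnx x" x] gap that by auto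
    then have "x = 0 \<or> x = s" if "x \<in># A" for x
      using xlnx_less_mult_ln[of x s] upper[OF that] nonneg[OF that] that 1 by force
    \<comment> \<open>On the two values 0 and \<open>s\<close> the power agrees with a linear
      function, so its sum depends on the mass alone.\<close>
    then have "x powr \<alpha> = x * s powr (\<alpha> - 1)" if "x \<in># A" for x
      using s(2) that by (fastforce simp: powr_diff)
    then have "(\<Sum>u\<in>#A. u powr \<alpha>) = (\<Sum>u\<in>#A. u * s powr (\<alpha> - 1))"
      by (intro arg_cong[where f = sum_mset] image_mset_cong)
    also have "\<dots> = s * s powr (\<alpha> - 1)"
      using s(1) by (simp add: sum_mset_distrib_right[symmetric])
    also have "\<dots> = s powr \<alpha>"
      using s(2) by (simp add: powr_diff)
    finally show ?thesis
      using 1 by simp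
  next
    case 2
    have "(\<Sum>u\<in>#A. u powr \<alpha>) \<le> (\<Sum>u\<in>#A. t powr \<alpha>)"
      using upper nonneg \<alpha> 2 by (intro sum_mset_mono powr_mono2) auto
    then show ?thesis
      using m by (simp add: 2[symmetric]) (simp add: algebra_simps)
  next
    case 3
    define a where "a = s - real m * t"
    obtain k b c where z: "pe_comb \<alpha> k b c t = 0" "pe_deriv \<alpha> b c t = 0" "pe_comb \<alpha> k b c a = 0"
      using pe_comb_exists_double[of t a \<alpha>] 3 a_def by auto
    have "pe_comb \<alpha> k b c x \<le> 0" if "x \<in># A" for x
      using pe_comb_sign_double_low[of \<alpha> t a k b c x] z that 3 \<alpha> nonneg upper a_def by auto
    then have "(\<Sum>u\<in>#A. pe_comb \<alpha> k b c u) \<le> (\<Sum>u\<in>#A. 0)"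
      by (intro sum_mset_mono) auto
    also have "\<dots> = (\<Sum>u\<in>#add_mset a (replicate_mset m t). pe_comb \<alpha> k b c u)"
      using z by simp
    finally show ?thesis
      unfolding sum_mset_pe_comb using s m entropy by (simp add: two_level_def a_def algebra_simps)
  qed
qed

text \<open>Dual to \<open>sum_powr_le_two_level\<close>: the entropy now bounds entries from below.
  The strict bound \<open>t < s / real m\<close> keeps the simple zero \<open>r\<close>
  positive.\<close>

lemma sum_powr_ge_two_level:
  assumes nonneg: "\<And>y. y \<in># A \<Longrightarrow> 0 \<le> y" and m: "0 < m" "size A = Suc m"
    and s: "\<Sum>\<^sub># A = s" "0 < s" and t: "s / (real m + 1) \<le> t" "t < s / real m"
    and entropy: "(\<Sum>u\<in>#A. xlnx u) = two_level m s t" and \<alpha>: "0 < \<alpha>"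
  shows "real m * t powr \<alpha> + (s - real m * t) powr \<alpha> \<le> (\<Sum>u\<in>#A. u powr \<alpha>)"
proof -
  define r where "r = s - real m * t"
  have mt: "s \<le> (real m + 1) * t"
    using t(1) by (simp add: field_simps)
  then have r: "0 < r" "r \<le> t"
    using t(2) m by (auto simp: r_def field_simps)
  have lower: "r \<le> x" if "x \<in># A" for x
  proof (rule ccontr)
    assume "\<not> ?thesis"
    then have "t < (s - x) / real m"
      using m by (simp add: r_def field_simps)
    moreover have "(s - x) / real m \<le> s / real m"
      using nonneg[OF that] by (intro divide_right_mono) auto
    ultimately have "two_level m s t < two_level m s ((s - x) / real m)"
      using two_level_strict_increasing[of m s t "(s - x) / real m"] m s t by auto
    then show False
      using sum_xlnx_ge_two_level[of A m x] nonneg m that s entropy by auto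
  qed
  show ?thesis
  proof (cases "r = t")
    case True
    have "(\<Sum>u\<in>#A. t powr \<alpha>) \<le> (\<Sum>u\<in>#A. u powr \<alpha>)"
      using lower r \<alpha> True by (intro sum_mset_mono powr_mono2) auto
    then show ?thesis
      using True m by (simp add: r_def algebra_simps)
  next
    case False
    obtain k b c where z: "pe_comb \<alpha> k b c t = 0" "pe_deriv \<alpha> b c t = 0" "pe_comb \<alpha> k b c r = 0"
      using pe_comb_exists_double[of t r \<alpha>] False r by auto
    have "0 \<le> pe_comb \<alpha> k b c x" if "x \<in># A" for x
      using pe_comb_sign_double_high[of \<alpha> r t k b c x] z that False r \<alpha> lower by auto
    then have "0 \<le> (\<Sum>u\<in>#A. pe_comb \<alpha> k b c u)"
      by (rule sum_mset_nonneg)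
    moreover have "(\<Sum>u\<in>#add_mset r (replicate_mset m t). pe_comb \<alpha> k b c u) = 0"
      using z by simp
    ultimately show ?thesis
      unfolding sum_mset_pe_comb using s m entropy by (simp add: two_level_def r_def algebra_simps)
  qed
qed

lemma two_level_surj_increasing:
  assumes "0 < m" "0 < s" "s / (real m + 1) \<le> t" "t \<le> s / real m"
    and "s * ln (s / (real m + 1)) \<le> E" "E \<le> two_level m s t"
  obtains u where "s / (real m + 1) \<le> u" "u \<le> t" "two_level m s u = E"
proof -
  have "continuous_on {s / (real m + 1)..t} (two_level m s)"
    using assms by (intro continuous_on_two_level) (auto intro: order_trans[rotated])
  then show ?thesis
    using IVT'[of "two_level m s" "s / (real m + 1)" E t] assms two_level_balanced[of s m] that
    by auto
qed

text \<open>Drives the smallest entry \<open>lo\<close> to \<open>0\<close>, turning \<open>hi\<close> into \<open>s - m u\<close>.\<close>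

lemma two_level_powr_le_three_level:
  assumes m: "0 < m" and lo: "0 < lo" "lo \<le> hi" "hi < t" and \<alpha>: "0 < \<alpha>"
    and s: "s = real m * t + lo + hi"
    and E: "E = real m * xlnx t + xlnx lo + xlnx hi" "s * ln (s / (real m + 1)) \<le> E"
  obtains u where "s / (real m + 1) \<le> u" "u < s / real m" "two_level m s u = E"
    "real m * u powr \<alpha> + (s - real m * u) powr \<alpha> \<le> real m * t powr \<alpha> + lo powr \<alpha> + hi powr \<alpha>"
proof -
  have s0: "0 < s"
    using m lo s by (auto intro!: add_nonneg_pos add_pos_pos)
  have st: "t < s / real m"
    using m lo s by (simp add: field_simps)
  \<comment> \<open>Merging \<open>lo\<close> and \<open>hi\<close> into one entry lowers the
    entropy, while \<open>E < s * ln t\<close> below puts the balanced point left of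
    \<open>t\<close>; so \<open>E\<close> is attained between the two.\<close>
  have "xlnx lo + xlnx hi < (lo + hi) * ln (lo + hi)"
    using xlnx_less_mult_ln[of lo "lo + hi"] xlnx_less_mult_ln[of hi "lo + hi"] lo
    by (simp add: algebra_simps)
  then have Et: "E < two_level m s t"
    using s E by (simp add: two_level_def xlnx_def)
  have "E < s * ln t"
    using add_strict_mono[OF xlnx_less_mult_ln[of lo t] xlnx_less_mult_ln[of hi t]] lo
    unfolding E(1) s by (simp add: algebra_simps xlnx_def)
  then have "s * ln (s / (real m + 1)) < s * ln t"
    using E by simp
  then have "s / (real m + 1) \<le> t"
    using s0 lo by simp
  then obtain u where u: "s / (real m + 1) \<le> u" "u \<le> t" "two_level m s u = E"
    using two_level_surj_increasing[of m s t E] m s0 st E Et by auto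
  then have "u < t"
    using Et by (metis order_le_less less_irrefl)
  define r where "r = s - real m * u"
  have "real m * u < real m * t"
    using \<open>u < t\<close> m by simp
  then have r: "hi < r" "r \<le> u"
    using u(1) lo s by (auto simp: r_def field_simps)
  \<comment> \<open>Zeros are placed at \<open>lo\<close> and \<open>t\<close> of the old vector and
    \<open>r\<close> of the new one. The other new entries 0 and \<open>u\<close> then fall where
    the sign is nonpositive, and the old entry \<open>hi\<close> where it is nonnegative.\<close>
  obtain k b c where z: "pe_comb \<alpha> k b c lo = 0" "pe_comb \<alpha> k b c r = 0" "pe_comb \<alpha> k b c t = 0"
    using pe_comb_exists_three_zeros[of lo r t \<alpha>] lo r \<open>u < t\<close> by auto
  note sign = pe_comb_sign_three_zeros[of \<alpha> lo r t k b c]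
  have "pe_comb \<alpha> k b c 0 \<le> 0" "0 \<le> pe_comb \<alpha> k b c hi" "pe_comb \<alpha> k b c u \<le> 0"
    using sign(1) sign(2)[of hi] sign(3)[of u] z lo r \<open>u < t\<close> \<alpha> by auto
  \<comment> \<open>The entry 0 pads the new vector to \<open>m + 2\<close> entries, so the
    multiplier \<open>k\<close> of the length cancels.\<close>
  then have "(\<Sum>u\<in>#{#0, r#} + replicate_mset m u. pe_comb \<alpha> k b c u)
      \<le> (\<Sum>u\<in>#{#lo, hi#} + replicate_mset m t. pe_comb \<alpha> k b c u)"
    using z by (simp add: mult_nonneg_nonpos) (smt (verit) mult_nonneg_nonpos of_nat_0_le_iff)
  moreover have "xlnx r + real m * xlnx u = xlnx lo + xlnx hi + real m * xlnx t"
    using u(3) E by (simp add: two_level_def r_def)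
  moreover have "r + real m * u = lo + hi + real m * t"
    using s by (simp add: r_def)
  ultimately have "r powr \<alpha> + real m * u powr \<alpha> \<le> lo powr \<alpha> + hi powr \<alpha> + real m * t powr \<alpha>"
    unfolding sum_mset_pe_comb by (simp add: add.assoc)
  then show ?thesis
    using that[of u] u \<open>u < t\<close> st by (simp add: r_def algebra_simps)
qed

section \<open>Existence, extremality and uniqueness of equalized vectors\<close>

text \<open>The vectors \<open>w\<^sub>n\<close>, scaled to total mass \<open>s\<close> and with \<open>\<Sum> x ln x = E\<close>: \<open>m\<close> entries equal to
  \<open>p\<close>, one entry \<open>s - m p < p\<close>, and zeros; the entry \<open>s - m p\<close> has no room when \<open>m = n\<close>.\<close>

definition equalized :: "nat \<Rightarrow> real \<Rightarrow> real \<Rightarrow> nat \<Rightarrow> real \<Rightarrow> bool" where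
  "equalized n s E m p \<longleftrightarrow> 0 < m \<and> m \<le> n \<and> real m * p \<le> s \<and> s < (real m + 1) * p
    \<and> (m = n \<longrightarrow> s = real m * p) \<and> two_level m s p = E"

text \<open>At the balanced point the remainder equals \<open>u\<close>, against the strict
  inequality in \<open>equalized\<close>; the vector is then recounted as \<open>m + 1\<close>
  copies with remainder 0, which \<open>m < n\<close> permits.\<close>

lemma equalized_intro:
  assumes "0 < m" "0 < s" "s / (real m + 1) \<le> u" "u \<le> s / real m" "m < n"
  obtains m' where "equalized n s (two_level m s u) m' u"
    "real m' * u powr \<alpha> + (s - real m' * u) powr \<alpha> = real m * u powr \<alpha> + (s - real m * u) powr \<alpha>"
proof (cases "s / (real m + 1) = u")
  case True
  moreover from this have "0 < u"
    using assms(2) divide_pos_pos[of s "real m + 1"] by simp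
  ultimately have u: "s = (real m + 1) * u" "0 < u"
    by (auto simp: field_simps)
  have "equalized n s (two_level m s u) (Suc m) u"
    using u assms by (auto simp: equalized_def two_level_def algebra_simps)
  then show ?thesis
    using that[of "Suc m"] u by (simp add: algebra_simps)
next
  case False
  then have "s / (real m + 1) < u" "0 < real m + 1"
    using assms by auto
  then have "s < (real m + 1) * u"
    by (simp add: field_simps)
  then have "equalized n s (two_level m s u) m u"
    using assms by (auto simp: equalized_def field_simps)
  then show ?thesis
    using that[of m] by simp
qed

lemma exists_equalized:
  assumes "\<And>y. y \<in># A \<Longrightarrow> 0 \<le> y" "0 < \<Sum>\<^sub># A" "0 < \<alpha>"
  shows "\<exists>m p. equalized (size A) (\<Sum>\<^sub># A) (\<Sum>u\<in>#A. xlnx u) m p \<and>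
    real m * p powr \<alpha> + (\<Sum>\<^sub># A - real m * p) powr \<alpha> \<le> (\<Sum>u\<in>#A. u powr \<alpha>)"
  using assms(1,2)
proof (induction "size A" arbitrary: A rule: less_induct)
  case less
  define s E S where "s = \<Sum>\<^sub># A" and "E = (\<Sum>u\<in>#A. xlnx u)" and "S = (\<Sum>u\<in>#A. u powr \<alpha>)"
  note defs = s_def E_def S_def
  have s: "0 < s"
    using less.prems defs by simp
  \<comment> \<open>Fewer entries suffice: the missing ones are filled with zeros, which
    \<open>equalized\<close> tolerates.\<close>
  have smaller: ?case
    if B: "size B < size A" "\<Sum>\<^sub># B = s" "(\<Sum>u\<in>#B. xlnx u) = E" "(\<Sum>u\<in>#B. u powr \<alpha>) \<le> S"
      "\<And>y. y \<in># B \<Longrightarrow> 0 \<le> y" for B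
  proof -
    obtain m p where "equalized (size B) s E m p"
      "real m * p powr \<alpha> + (s - real m * p) powr \<alpha> \<le> S"
      using less.hyps[OF B(1)] B s by fastforce
    moreover from this have "equalized (size A) s E m p"
      using B(1) by (auto simp: equalized_def)
    ultimately show ?thesis
      unfolding defs by blast
  qed
  have two_level_case: ?case
    if "0 < m" "m < size A" "s / (real m + 1) \<le> u" "u \<le> s / real m" "two_level m s u = E"
      "real m * u powr \<alpha> + (s - real m * u) powr \<alpha> \<le> S" for m u
    using equalized_intro[of m s u "size A" \<alpha>] that s unfolding defs by metis
  obtain x where x: "x \<in># A" "\<And>y. y \<in># A \<Longrightarrow> x \<le> y"
  proof -
    have "A \<noteq> {#}"
      using less.prems by auto
    then show ?thesis
      using that[of "Min (set_mset A)"] by simp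
  qed
  obtain B where A: "A = add_mset x B"
    using x(1) by (metis insert_DiffM)
  define n where "n = size B"
  have xB: "\<And>y. y \<in># B \<Longrightarrow> x \<le> y" and B0: "\<And>y. y \<in># B \<Longrightarrow> 0 \<le> y" and x0: "0 \<le> x"
    using x(2) less.prems(1) A by auto
  have sB: "\<Sum>\<^sub># B = s - x"
    using A s_def by simp
  consider "B = {#}" | "x = 0" | "0 < x" "B \<noteq> {#}"
    using x0 by linarith
  then show ?case
  proof cases
    case 1
    then show ?thesis
      using A s s_def by (intro exI[of _ 1] exI[of _ x]) (auto simp: equalized_def two_level_def)
  next
    case 2
    then show ?thesis
      using smaller[of B] A defs B0 by auto
  next
    case 3
    then have n: "0 < n"
      by (simp add: n_def nonempty_has_size)
    have "real n * x \<le> s - x"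
    proof -
      have "(\<Sum>y\<in>#B. x) \<le> (\<Sum>y\<in>#B. y)"
        using xB by (intro sum_mset_mono)
      then show ?thesis
        by (simp add: sB n_def)
    qed
    show ?thesis
    \<comment> \<open>\<open>E\<close> is the negated entropy and \<open>n\<close> is one less than
      the number of entries, so this says that \<open>n\<close> equal entries have too little
      entropy; the target then has \<open>n\<close> equal entries and a positive remainder.\<close>
    proof (cases "E < s * ln (s / real n)")
      case True
      have "s * ln (s / (real n + 1)) \<le> E"
        using sum_xlnx_ge_uniform[of A] less.prems A by (simp add: defs n_def add.commute)
      then obtain u where u: "s / (real n + 1) \<le> u" "u \<le> s / real n" "two_level n s u = E"
        using two_level_surj_increasing[of n s "s / real n" E] n s True two_level_full[of n s]
        by (auto simp: field_simps)
      moreover have "u \<noteq> s / real n"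
        using u(3) True two_level_full[OF n] by auto
      ultimately show ?thesis
        using two_level_case[of n u] sum_powr_ge_two_level[of A n s u \<alpha>] n s less.prems(1) assms(3) A
        by (simp add: defs n_def)
    next
      case False
      obtain m p where mp: "equalized n (s - x) (E - xlnx x) m p"
        "real m * p powr \<alpha> + (s - x - real m * p) powr \<alpha> \<le> S - x powr \<alpha>"
      proof -
        have "0 < s - x"
          using \<open>real n * x \<le> s - x\<close> n 3
          by (smt (verit) mult_pos_pos of_nat_0_less_iff)
        moreover have "(\<Sum>u\<in>#B. xlnx u) = E - xlnx x" "(\<Sum>u\<in>#B. u powr \<alpha>) = S - x powr \<alpha>"
          by (simp_all add: A E_def S_def)
        ultimately have "\<exists>m p. equalized n (s - x) (E - xlnx x) m p \<and>
            real m * p powr \<alpha> + (s - x - real m * p) powr \<alpha> \<le> S - x powr \<alpha>"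
          using less.hyps[of B] A B0 sB by (simp add: n_def)
        then show ?thesis
          using that by blast
      qed
      define r where "r = s - x - real m * p"
      have m: "0 < m" "m \<le> n" and r: "0 \<le> r" "r < p" "m = n \<Longrightarrow> r = 0"
        and E: "E = xlnx x + xlnx r + real m * xlnx p"
        using mp(1) by (auto simp: equalized_def r_def two_level_def algebra_simps)
      have S: "x powr \<alpha> + r powr \<alpha> + real m * p powr \<alpha> \<le> S"
        using mp(2) by (simp add: r_def algebra_simps)
      \<comment> \<open>\<open>real n * x\<close> is at most the mass \<open>real m * p + r\<close>
        of the equalized rest, which is at most \<open>real n * p\<close>.\<close>
      have "real n * x \<le> real n * p"
      proof (cases "m = n")
        case True
        then show ?thesis
          using \<open>real n * x \<le> s - x\<close> r r_def by simp
      next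
        case False
        then have "(real m + 1) * p \<le> real n * p"
          using m r by (intro mult_right_mono) auto
        then show ?thesis
          using \<open>real n * x \<le> s - x\<close> r r_def by (simp add: algebra_simps)
      qed
      then have xp: "x \<le> p"
        using n by simp
      have p: "0 < p"
        using r by simp
      \<comment> \<open>All entries are at most \<open>p\<close>, so
        \<open>E \<le> s * ln p\<close>; were \<open>p\<close> below \<open>s / real n\<close>, this
        would contradict the failed case condition. It also excludes \<open>m = n\<close>, where the
        positive \<open>x\<close> would make \<open>s\<close> exceed
        \<open>real n * p\<close>.\<close>
      have not_flat: False if "real n * p < s" "E \<le> s * ln p"
      proof -
        have "p < s / real n"
          using that n by (simp add: field_simps)
        then have "s * ln p < s * ln (s / real n)"
          using s p by simp
        then show False
          using that False by simp
      qed
      have "E \<le> s * ln p"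
        using xlnx_le_mult_ln[of x p] xlnx_le_mult_ln[of r p] xp x0 r
        unfolding E by (simp add: r_def xlnx_def algebra_simps)
      then have flat: "\<not> real n * p < s"
        using not_flat by blast
      have "m \<noteq> n"
        using flat r 3 r_def by auto
      then have mn: "m < n"
        using m by simp
      show ?thesis
      proof (cases "m + 1 < n \<or> r = 0")
        case True
        \<comment> \<open>Here \<open>x\<close>, the positive remainder if any and the
          \<open>m\<close> copies of \<open>p\<close> number less than \<open>size A\<close>, so the
          induction hypothesis applies once more.\<close>
        define B' where "B' = replicate_mset m p + (if r = 0 then {#x#} else {#x, r#})"
        show ?thesis
          using True mn A n_def E S p r x0 assms(3)
          by (intro smaller[of B']) (auto simp: B'_def r_def split: if_splits)
      next
        case False
        then have mn1: "n = m + 1" and r0: "0 < r"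
          using mn r by auto
        have less_p: "x < p"
        proof (rule ccontr)
          assume "\<not> x < p"
          then show False
            using flat xp r0 mn1 r_def by (simp add: algebra_simps)
        qed
        have low: "s * ln (s / (real m + 1)) \<le> E"
          using \<open>\<not> E < s * ln (s / real n)\<close> mn1 by (simp add: add.commute)
        \<comment> \<open>The remainder \<open>r\<close> produced by the induction may be smaller
          than \<open>x\<close>, so the two have to be ordered anew.\<close>
        define lo hi where "lo = min x r" and "hi = max x r"
        have lohi: "lo + hi = x + r" "xlnx lo + xlnx hi = xlnx x + xlnx r"
          "lo powr \<alpha> + hi powr \<alpha> = x powr \<alpha> + r powr \<alpha>" "0 < lo" "lo \<le> hi" "hi < p"
          using r0 less_p r 3 by (auto simp: lo_def hi_def min_def max_def)
        have "s = real m * p + lo + hi" "E = real m * xlnx p + xlnx lo + xlnx hi"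
          using lohi E by (auto simp: r_def)
        then obtain u where u: "s / (real m + 1) \<le> u" "u < s / real m" "two_level m s u = E"
          "real m * u powr \<alpha> + (s - real m * u) powr \<alpha> \<le> real m * p powr \<alpha> + lo powr \<alpha> + hi powr \<alpha>"
          using two_level_powr_le_three_level[of m lo hi p \<alpha> s E] m(1) lohi low assms(3) by blast
        show ?thesis
          using u lohi S m(1) mn A by (intro two_level_case[of m u]) (auto simp: n_def)
      qed
    qed
  qed
qed

text \<open>The ends belong to the uniform vectors with \<open>m + 1\<close> and \<open>m\<close>
  entries. The half-open intervals for different \<open>m\<close> are disjoint, so \<open>E\<close>
  determines \<open>m\<close>.\<close>

lemma equalized_bounds:
  assumes "equalized n s E m p" "0 < s"
  shows "s * ln (s / (real m + 1)) < E" "E \<le> s * ln (s / real m)"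
proof -
  have e: "0 < m" "s / (real m + 1) < p" "p \<le> s / real m" "two_level m s p = E"
    using assms by (auto simp: equalized_def field_simps)
  then show "s * ln (s / (real m + 1)) < E"
    using two_level_strict_increasing[of m s "s / (real m + 1)" p] two_level_balanced[of s m] assms(2)
    by auto
  show "E \<le> s * ln (s / real m)"
    using two_level_strict_increasing[of m s p "s / real m"] two_level_full[of m s] assms(2) e
    by (cases "p = s / real m") auto
qed

text \<open>Serves as injectivity of the entropy along the family \<open>w\<close>: the interval
  containing \<open>E\<close> fixes \<open>m\<close>, then strict monotonicity of
  \<open>two_level\<close> fixes \<open>p\<close>.\<close>

lemma equalized_unique:
  assumes "equalized n s E m p" "equalized n s E m' p'" "0 < s"
  shows "m = m' \<and> p = p'"
proof -
  have le: "k \<le> l" if "equalized n s E k q" "equalized n s E l t" for k l q t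
  proof (rule ccontr)
    assume "\<not> k \<le> l"
    moreover have pos: "0 < k" "0 < l"
      using that by (auto simp: equalized_def)
    ultimately have "s * ln (s / real k) \<le> s * ln (s / (real l + 1))"
      using assms(3) by (intro mult_left_mono) (auto simp: frac_le)
    then show False
      using equalized_bounds[OF that(1) assms(3)] equalized_bounds[OF that(2) assms(3)] by linarith
  qed
  have m: "m' = m"
    using le assms by (metis order_antisym)
  have "0 < m" "s / (real m + 1) < p" "p \<le> s / real m" "two_level m s p = E"
    "s / (real m + 1) < p'" "p' \<le> s / real m" "two_level m s p' = E"
    using assms m by (auto simp: equalized_def field_simps)
  then have "p = p'"
    using two_level_strict_increasing[of m s p p'] two_level_strict_increasing[of m s p' p] assms(3)
    by (cases p p' rule: linorder_cases) auto
  then show ?thesis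
    using m by simp
qed

subsection \<open>Probability vectors\<close>

definition entries :: "nat \<Rightarrow> (nat \<Rightarrow> real) \<Rightarrow> real multiset" where
  "entries n q = image_mset q (mset_set {1..n})"

lemma size_entries [simp]: "size (entries n q) = n"
  by (simp add: entries_def)

lemma sum_entries: "(\<Sum>u\<in>#entries n q. f u) = (\<Sum>i=1..n. f (q i))"
  by (simp add: entries_def sum_unfold_sum_mset image_mset.compositionality comp_def)

lemma sum_entries_eq_1: "q \<in> prob_simplex n \<Longrightarrow> \<Sum>\<^sub># (entries n q) = 1"
  using sum_entries[of "\<lambda>x. x" n q] by (simp add: prob_simplex_def)

lemma entries_nonneg: "q \<in> prob_simplex n \<Longrightarrow> u \<in># entries n q \<Longrightarrow> 0 \<le> u"
  by (auto simp: entries_def prob_simplex_def)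

lemma shannon_entropy_eq: "shannon_entropy n q = - (\<Sum>i=1..n. xlnx (q i))"
  by (simp add: shannon_entropy_def xlnx_def)

lemma shannon_entropy_entries: "shannon_entropy n q = - (\<Sum>u\<in>#entries n q. xlnx u)"
  by (simp add: shannon_entropy_eq sum_entries)

lemma sum_vdist:
  assumes "1 \<le> n"
  shows "(\<Sum>i=1..n. f (vdist n t i)) = real (n - 1) * f t + f (1 - real (n - 1) * t)"
proof -
  have "{1..n} = insert 1 {2..n}"
    using assms by auto
  then have "(\<Sum>i=1..n. f (vdist n t i)) = f (1 - real (n - 1) * t) + (\<Sum>i=2..n. f (vdist n t i))"
    using assms by (simp add: vdist_def of_nat_diff)
  also have "(\<Sum>i=2..n. f (vdist n t i)) = (\<Sum>i=2..n. f t)"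
    by (intro sum.cong) (auto simp: vdist_def)
  also have "\<dots> = real (n - 1) * f t"
    by simp
  finally show ?thesis
    by simp
qed

lemma vdist_in_prob_simplex:
  assumes "1 \<le> n" "t \<in> {0..1 / real n}"
  shows "vdist n t \<in> prob_simplex n"
proof -
  have "real n * t \<le> 1"
    using assms by (auto simp: field_simps)
  moreover have "0 \<le> t"
    using assms by simp
  ultimately have "(real n - 1) * t \<le> 1"
    by (simp add: algebra_simps)
  then show ?thesis
    using assms sum_vdist[of n "\<lambda>x. x" t] by (auto simp: prob_simplex_def vdist_def)
qed

lemma shannon_entropy_vdist:
  "1 \<le> n \<Longrightarrow> shannon_entropy n (vdist n t) = - two_level (n - 1) 1 t"
  unfolding shannon_entropy_eq two_level_def using sum_vdist[of n xlnx t] by simp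

lemma nat_floor_inverse_eq:
  assumes "real m * p \<le> 1" "1 < (real m + 1) * p" "0 < p"
  shows "nat \<lfloor>1 / p\<rfloor> = m"
proof -
  have "real m \<le> 1 / p" "1 / p < real m + 1"
    using assms by (auto simp: field_simps)
  then have "\<lfloor>1 / p\<rfloor> = int m"
    by (simp add: floor_eq_iff)
  then show ?thesis
    by simp
qed

lemma sum_wdist:
  assumes "equalized n 1 E m p" "f 0 = 0"
  shows "(\<Sum>i=1..n. f (wdist n p i)) = real m * f p + f (1 - real m * p)"
proof -
  have e: "m \<le> n" "real m * p \<le> 1" "1 < (real m + 1) * p" "m = n \<Longrightarrow> 1 - real m * p = 0"
    using assms(1) by (auto simp: equalized_def)
  then have "0 < (real m + 1) * p"
    by linarith
  then have "0 < p"
    by (simp add: zero_less_mult_iff)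
  then have m: "nat \<lfloor>1 / p\<rfloor> = m"
    using e nat_floor_inverse_eq by blast
  have w: "wdist n p i = (if i \<le> m then p else if i = m + 1 then 1 - real m * p else 0)"
    if "i \<in> {1..n}" for i
    using that by (simp add: wdist_def m)
  have "(\<Sum>i=1..n. f (wdist n p i))
      = (\<Sum>i=1..n. (if i \<le> m then f p else 0) + (if i = m + 1 then f (1 - real m * p) else 0))"
    using w assms(2) by (intro sum.cong) auto
  also have "\<dots> = (\<Sum>i=1..n. if i \<le> m then f p else 0) + (if m + 1 \<in> {1..n} then f (1 - real m * p) else 0)"
    by (simp add: sum.distrib)
  also have "(\<Sum>i=1..n. if i \<le> m then f p else 0) = (\<Sum>i=1..m. f p)"
    using e(1) by (intro sum.mono_neutral_cong_right) auto
  finally have *: "(\<Sum>i=1..n. f (wdist n p i)) =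
      real m * f p + (if m + 1 \<in> {1..n} then f (1 - real m * p) else 0)"
    by simp
  \<comment> \<open>For \<open>m = n\<close> no position is left for the remainder, but it is 0 and
    contributes \<open>f 0 = 0\<close>.\<close>
  have "f (1 - real m * p) = 0" if "m = n"
    using e(4) that assms(2) by simp
  then show ?thesis
    using e(1) unfolding * by (cases "m = n") auto
qed

text \<open>Brings a value of \<open>inv_entropy_w\<close>, known only through its interval and its
  entropy, within reach of \<open>equalized_unique\<close>.\<close>

lemma equalized_of_parameter:
  assumes "1 \<le> n" "p \<in> {1 / real n..1}"
  obtains m where "equalized n 1 (two_level m 1 p) m p"
proof -
  define m where "m = nat \<lfloor>1 / p\<rfloor>"
  have n: "1 \<le> real n * p" "p \<le> 1"
    using assms by (auto simp: field_simps)
  have p: "0 < p"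
    using assms by (auto intro: less_le_trans[of 0 "1 / real n"])
  then have "1 \<le> 1 / p"
    using n by simp
  then have f: "0 < m" "real m \<le> 1 / p" "1 / p < real m + 1"
    unfolding m_def by linarith+
  then have mp: "real m * p \<le> 1" "1 < (real m + 1) * p"
    using p by (auto simp: field_simps)
  then have "real m * p \<le> real n * p"
    using n by linarith
  then have "m \<le> n"
    using p by simp
  moreover have "1 = real m * p" if "m = n"
    using that n mp by simp
  ultimately show ?thesis
    using that f mp by (auto simp: equalized_def)
qed

lemma equalized_parameter_range:
  assumes "equalized n 1 E m p" "1 \<le> n"
  shows "p \<in> {1 / real n..1}"
proof -
  have e: "0 < m" "m \<le> n" "real m * p \<le> 1" "1 < (real m + 1) * p" "m = n \<Longrightarrow> 1 = real m * p"
    using assms(1) by (auto simp: equalized_def)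
  then have "0 < (real m + 1) * p"
    by linarith
  then have p: "0 < p"
    by (simp add: zero_less_mult_iff)
  have "1 * p \<le> real m * p"
    using e(1) p by (intro mult_right_mono) auto
  moreover have "1 \<le> real n * p"
  proof (cases "m = n")
    case False
    then have "(real m + 1) * p \<le> real n * p"
      using e(2) p by (intro mult_right_mono) auto
    then show ?thesis
      using e(4) by simp
  qed (use e(5) in simp)
  ultimately show ?thesis
    using e(3) assms(2) by (simp add: field_simps)
qed

lemma wdist_in_prob_simplex:
  assumes "equalized n 1 E m p"
  shows "wdist n p \<in> prob_simplex n"
proof -
  have e: "real m * p \<le> 1" "1 < (real m + 1) * p"
    using assms by (auto simp: equalized_def)
  then have "0 < (real m + 1) * p"
    by linarith
  then have "0 < p"
    by (simp add: zero_less_mult_iff)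
  then have "nat \<lfloor>1 / p\<rfloor> = m"
    using e nat_floor_inverse_eq by blast
  then have "0 \<le> wdist n p i" for i
    using e \<open>0 < p\<close> by (simp add: wdist_def)
  moreover have "wdist n p i = 0" if "i \<notin> {1..n}" for i
    using that by (auto simp: wdist_def)
  ultimately show ?thesis
    using sum_wdist[OF assms, of "\<lambda>x. x"] by (auto simp: prob_simplex_def)
qed

lemma shannon_entropy_wdist:
  "equalized n 1 E m p \<Longrightarrow> shannon_entropy n (wdist n p) = - E"
  using sum_wdist[of n E m p xlnx] by (auto simp: shannon_entropy_eq two_level_def equalized_def)

section \<open>Extremality of the two families and the final inequalities\<close>

lemma vbar_extremal:
  assumes "2 \<le> n" "q \<in> prob_simplex n" "0 < \<alpha>"
  shows "vbar n q \<in> prob_simplex n"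
    and "(\<Sum>i=1..n. q i powr \<alpha>) \<le> (\<Sum>i=1..n. vbar n q i powr \<alpha>)"
proof -
  define A where "A = entries n q"
  define E where "E = (\<Sum>u\<in>#A. xlnx u)"
  have A: "\<And>u. u \<in># A \<Longrightarrow> 0 \<le> u" "\<Sum>\<^sub># A = 1" "size A = Suc (n - 1)" "0 < n - 1"
    using assms entries_nonneg sum_entries_eq_1 by (auto simp: A_def)
  have n: "real (n - 1) + 1 = real n"
    using assms by (simp add: of_nat_diff)
  have q: "shannon_entropy n q = - E"
    by (simp add: shannon_entropy_entries A_def E_def)
  have "E \<le> 0"
    using sum_xlnx_le_mult_ln[of A 1] member_le_sum_mset[of A] A by (simp add: E_def)
  moreover have "ln (1 / real n) \<le> E"
    using sum_xlnx_ge_uniform[of A] A by (simp add: E_def A_def)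
  moreover have "1 / real n \<le> 1 / real (n - 1)"
    using A(4) by (intro frac_le) auto
  then have "continuous_on {0..1 / real n} (two_level (n - 1) 1)"
    using A(4) by (intro continuous_on_two_level) auto
  \<comment> \<open>\<open>inv_into\<close> is meaningful only at attained values. Along
    \<open>v\<close> the negated entropy runs from 0 at \<open>t = 0\<close> to
    \<open>- ln n\<close> at \<open>1 / real n\<close>, so \<open>E\<close> is attained.\<close>
  ultimately obtain t where "t \<in> {0..1 / real n}" "two_level (n - 1) 1 t = E"
    using IVT2'[of "two_level (n - 1) 1" "1 / real n" E 0] two_level_balanced[of 1 "n - 1"] n
    by (auto simp: two_level_def)
  then have img: "shannon_entropy n q \<in> (\<lambda>t. shannon_entropy n (vdist n t)) ` {0..1 / real n}"
    using assms(1) q by (intro image_eqI[of _ _ t]) (auto simp: shannon_entropy_vdist)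
  define u where "u = inv_entropy_v n (shannon_entropy n q)"
  have u: "u \<in> {0..1 / real n}"
    unfolding u_def inv_entropy_v_def using img by (rule inv_into_into)
  have "shannon_entropy n (vdist n u) = shannon_entropy n q"
    unfolding u_def inv_entropy_v_def using img by (rule f_inv_into_f)
  then have "E = two_level (n - 1) 1 u"
    using assms(1) q by (simp add: shannon_entropy_vdist)
  then have "(\<Sum>x\<in>#A. x powr \<alpha>) \<le> real (n - 1) * u powr \<alpha> + (1 - real (n - 1) * u) powr \<alpha>"
    using A u n assms(3) by (intro sum_powr_le_two_level) (auto simp: E_def)
  then show "(\<Sum>i=1..n. q i powr \<alpha>) \<le> (\<Sum>i=1..n. vbar n q i powr \<alpha>)"
    using assms(1) sum_vdist[of n "\<lambda>x. x powr \<alpha>" u] by (simp add: vbar_def u_def sum_entries A_def)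
  show "vbar n q \<in> prob_simplex n"
    using vdist_in_prob_simplex[of n u] u assms(1) by (simp add: vbar_def u_def)
qed

lemma wbar_extremal:
  assumes "2 \<le> n" "q \<in> prob_simplex n" "0 < \<alpha>"
  shows "wbar n q \<in> prob_simplex n"
    and "(\<Sum>i=1..n. wbar n q i powr \<alpha>) \<le> (\<Sum>i=1..n. q i powr \<alpha>)"
proof -
  define E where "E = (\<Sum>u\<in>#entries n q. xlnx u)"
  obtain m p where mp: "equalized n 1 E m p"
    "real m * p powr \<alpha> + (1 - real m * p) powr \<alpha> \<le> (\<Sum>i=1..n. q i powr \<alpha>)"
    using exists_equalized[of "entries n q" \<alpha>] assms entries_nonneg sum_entries_eq_1
    by (auto simp: E_def sum_entries)
  have q: "shannon_entropy n q = - E"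
    by (simp add: shannon_entropy_entries E_def)
  \<comment> \<open>The parameter from \<open>exists_equalized\<close> already shows that this
    entropy is attained along \<open>w\<close>.\<close>
  have img: "shannon_entropy n q \<in> (\<lambda>t. shannon_entropy n (wdist n t)) ` {1 / real n..1}"
    using equalized_parameter_range[OF mp(1)] shannon_entropy_wdist[OF mp(1)] q assms(1)
    by (intro image_eqI[of _ _ p]) auto
  define u where "u = inv_entropy_w n (shannon_entropy n q)"
  have u: "u \<in> {1 / real n..1}"
    unfolding u_def inv_entropy_w_def using img by (rule inv_into_into)
  have Hu: "shannon_entropy n (wdist n u) = shannon_entropy n q"
    unfolding u_def inv_entropy_w_def using img by (rule f_inv_into_f)
  obtain k where k: "equalized n 1 (two_level k 1 u) k u"
    using equalized_of_parameter[of n u] u assms(1) by auto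
  then have "two_level k 1 u = E"
    using shannon_entropy_wdist[OF k] Hu q by simp
  \<comment> \<open>Uniqueness identifies the preimage chosen by \<open>inv_into\<close> with the
    parameter for which the power sum bound is known.\<close>
  then have "u = p"
    using equalized_unique[of n 1 E m p k u] mp(1) k by simp
  then have w: "wbar n q = wdist n p"
    by (simp add: wbar_def u_def)
  show "wbar n q \<in> prob_simplex n"
    unfolding w by (rule wdist_in_prob_simplex[OF mp(1)])
  show "(\<Sum>i=1..n. wbar n q i powr \<alpha>) \<le> (\<Sum>i=1..n. q i powr \<alpha>)"
    unfolding w using sum_wdist[OF mp(1), of "\<lambda>x. x powr \<alpha>"] mp(2) by simp
qed

lemma alpha_norm_mono:
  assumes "(\<Sum>i=1..n. q i powr \<alpha>) \<le> (\<Sum>i=1..n. q' i powr \<alpha>)" "0 < \<alpha>"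
  shows "alpha_norm n \<alpha> q \<le> alpha_norm n \<alpha> q'"
  unfolding alpha_norm_def using assms by (intro powr_mono2) (auto intro: sum_nonneg)

theorem corollary1:
  fixes n :: nat and p :: "nat \<Rightarrow> real" and \<alpha> :: real
    and f :: "real \<Rightarrow> real" and D :: "real set"
  assumes "2 \<le> n"
    and "p \<in> prob_simplex n"
    and "0 < \<alpha>"
    and "\<forall>q\<in>prob_simplex n. alpha_norm n \<alpha> q \<in> D"
  shows "(strict_mono_on D f \<longrightarrow>
            f (alpha_norm n \<alpha> (wbar n p)) \<le> f (alpha_norm n \<alpha> p) \<and>
            f (alpha_norm n \<alpha> p) \<le> f (alpha_norm n \<alpha> (vbar n p))) \<and>
         (strict_antimono_on D f \<longrightarrow>
            f (alpha_norm n \<alpha> (vbar n p)) \<le> f (alpha_norm n \<alpha> p) \<and>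
            f (alpha_norm n \<alpha> p) \<le> f (alpha_norm n \<alpha> (wbar n p)))"
proof -
  note v = vbar_extremal[OF assms(1-3)] and w = wbar_extremal[OF assms(1-3)]
  have "alpha_norm n \<alpha> (wbar n p) \<le> alpha_norm n \<alpha> p" "alpha_norm n \<alpha> p \<le> alpha_norm n \<alpha> (vbar n p)"
    using alpha_norm_mono v(2) w(2) assms(3) by blast+
  moreover have "alpha_norm n \<alpha> (wbar n p) \<in> D" "alpha_norm n \<alpha> p \<in> D" "alpha_norm n \<alpha> (vbar n p) \<in> D"
    using assms(2,4) v(1) w(1) by blast+
  moreover have "f x \<le> f y" if "strict_mono_on D f" "x \<in> D" "y \<in> D" "x \<le> y" for x y
    using that by (metis order_le_less strict_mono_onD)
  moreover have "f y \<le> f x" if "strict_antimono_on D f" "x \<in> D" "y \<in> D" "x \<le> y" for x y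
    using that by (metis monotone_onD order_le_less)
  ultimately show ?thesis
    by blast
qed

end
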